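(* Let $\alpha \in [-\infty, 1)$ and let $w_j$, $j \geq 1$, be the associated weights $w_j = \prod_{i=1}^{j-1}(i-\alpha)$ (with $w_1 = 1$) if $\alpha > -\infty$, and $w_j = 1$ for all $j$ if $\alpha = -\infty$. For each $n \geq 1$ there exists a random sequence of vectors $\left(B_1^{n,k}, \dots, B_n^{n,k}\right)$, $k = 1, 2, \dots, n$, defined on a common probability space, such that for each $1 \leq k \leq n$, $$\left(B_1^{n,k}, \dots, B_n^{n,k}\right) \stackrel{d}{=} \left(B_1, \dots, B_n \mid K_n = k\right),$$ and such that $B_i^{n,k+1} \geq B_i^{n,k}$ for all $1 \leq i \leq n$ and all $1 \leq k \leq n-1$. Here $\left(B_1, \dots, B_n \mid K_n = k\right)$ denotes the vector of indicators $B_i$ of the event that $i$ is the smallest element of its block in a Gibbs$(\mathbf{w})$ random partition of $[n]$ into $k$ blocks.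
   Context: Write $[n]=\{1,\dots,n\}$ and let $\mathcal{P}^n_k$ be the set of partitions of $[n]$ into exactly $k$ (non-empty) blocks. Given a triangular array of non-negative reals $\mathbf{v} = (v_{n,k})_{1\le k\le n}$ and weights $\mathbf{w}=(w_j)_{j\ge1}$ with $\sum_{k=1}^n v_{n,k} \sum_{\{A_1,\dots,A_k\}\in\mathcal{P}^n_k}\prod_{j=1}^k w_{|A_j|} = 1$, a random partition $\Pi$ of $[n]$ has the Gibbs$(\mathbf{v},\mathbf{w})$ distribution if $\mathbb{P}(\Pi=\{A_1,\dots,A_k\}) = v_{n,k}\prod_{j=1}^k w_{|A_j|}$ for every $1\le k\le n$ and $\{A_1,\dots,A_k\}\in\mathcal{P}^n_k$. For such a $\Pi$, $B_i$ is the indicator of the event that $i$ is the smallest element in its block, and $K_n=\sum_{i=1}^n B_i$ is the number of blocks. The conditional law of $\Pi$ given $K_n=k$ does not depend on $\mathbf{v}$; it is the Gibbs$(\mathbf{w})$ distribution on $\mathcal{P}^n_k$: $$\mathbb{P}(\Pi=\{A_1,\dots,A_k\}\mid K_n=k) = \frac{\prod_{j=1}^k w_{|A_j|}}{\sum_{\{A'_1,\dots,A'_k\}\in\mathcal{P}^n_k}\prod_{j=1}^k w_{|A'_j|}}.$$ Conditioning on $K_n=k$ is understood in this sense for every $1\le k\le n$. *)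

theory Defs
  imports "HOL-Probability.Probability"
begin

definition partitions_into :: "nat \<Rightarrow> nat \<Rightarrow> nat set set set" where
  "partitions_into n k = {P. partition_on {1..n} P \<and> card P = k}"

definition gibbs_weight :: "(nat \<Rightarrow> real) \<Rightarrow> nat set set \<Rightarrow> real" where
  "gibbs_weight w P = (\<Prod>A\<in>P. w (card A))"

text \<open>
  The Gibbs(\<open>w\<close>) distribution on the partitions of \<open>{1..n}\<close> into \<open>k\<close> blocks. Since
  \<^const>\<open>embed_pmf\<close> is meaningful only for functions that sum to one, the definition is to be
  used for positive weights and \<open>1 \<le> k \<le> n\<close>; see \<open>pmf_gibbs_pmf\<close> below.
\<close>
definition gibbs_pmf :: "(nat \<Rightarrow> real) \<Rightarrow> nat \<Rightarrow> nat \<Rightarrow> nat set set pmf" where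
  "gibbs_pmf w n k = embed_pmf (\<lambda>P. if P \<in> partitions_into n k
     then gibbs_weight w P / (\<Sum>Q\<in>partitions_into n k. gibbs_weight w Q) else 0)"

definition gibbs_alpha_weight :: "ereal \<Rightarrow> nat \<Rightarrow> real" where
  "gibbs_alpha_weight \<alpha> j =
     (if \<alpha> = -\<infinity> then 1 else (\<Prod>i\<in>{1..<j}. real i - real_of_ereal \<alpha>))"

definition block_min_ind :: "nat set set \<Rightarrow> nat \<Rightarrow> nat" where
  "block_min_ind P i = of_bool (\<exists>A\<in>P. i \<in> A \<and> (\<forall>j\<in>A. i \<le> j))"

text \<open>
  The law of \<open>(B\<^sub>1, \<dots>, B\<^sub>n)\<close> given \<open>K\<^sub>n = k\<close>. A vector indexed by
  \<open>{1..n}\<close> is a function made \<^const>\<open>undefined\<close> outside \<open>{1..n}\<close>.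
\<close>
definition block_min_law :: "(nat \<Rightarrow> real) \<Rightarrow> nat \<Rightarrow> nat \<Rightarrow> (nat \<Rightarrow> nat) pmf" where
  "block_min_law w n k = map_pmf (\<lambda>P. \<lambda>i\<in>{1..n}. block_min_ind P i) (gibbs_pmf w n k)"

lemma gibbs_alpha_weight_pos:
  assumes "\<alpha> < 1"
  shows "gibbs_alpha_weight \<alpha> j > 0"
proof (cases \<alpha>)
  case (real r)
  with assms have "r < 1" by simp
  then show ?thesis
    using real by (auto simp: gibbs_alpha_weight_def intro!: prod_pos)
qed (use assms in \<open>auto simp: gibbs_alpha_weight_def\<close>)

lemma finite_partitions_into: "finite (partitions_into n k)"
proof -
  have "finite {P. partition_on {1..n} P}" by (rule finitely_many_partition_on) simp
  then show ?thesis
    by (rule rev_finite_subset) (auto simp: partitions_into_def)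
qed

lemma partitions_into_nonempty:
  assumes "1 \<le> k" "k \<le> n"
  shows "partitions_into n k \<noteq> {}"
proof -
  let ?S = "(\<lambda>i. {i}) ` {1..<k}"
  let ?P = "insert {k..n} ?S"
  have "partition_on {1..n} ?P"
  proof (rule partition_onI)
    show "\<Union>?P = {1..n}"
      using assms by auto
    show "disjnt p q" if "p \<in> ?P" "q \<in> ?P" "p \<noteq> q" for p q
      using that by (auto simp: disjnt_def)
    show "{} \<notin> ?P"
      using assms by auto
  qed
  moreover have "{k..n} \<notin> ?S"
  proof
    assume "{k..n} \<in> ?S"
    then obtain i where i: "i < k" "{k..n} = {i}" by auto
    have "k \<in> {k..n}" using assms by simp
    then have "k = i" unfolding i(2) by simp
    with i(1) show False by simp
  qed
  then have "card ?P = Suc (card ?S)"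
    by (intro card_insert_disjoint) auto
  moreover have "card ?S = k - 1"
    by (subst card_image) auto
  ultimately have "?P \<in> partitions_into n k"
    using assms by (simp add: partitions_into_def)
  then show ?thesis by blast
qed

lemma pmf_gibbs_pmf:
  assumes w: "\<And>j. j \<ge> 1 \<Longrightarrow> w j > 0" and k: "1 \<le> k" "k \<le> n"
  shows "pmf (gibbs_pmf w n k) P = (if P \<in> partitions_into n k
     then gibbs_weight w P / (\<Sum>Q\<in>partitions_into n k. gibbs_weight w Q) else 0)"
proof -
  let ?S = "partitions_into n k" and ?Z = "\<Sum>Q\<in>partitions_into n k. gibbs_weight w Q"
  let ?f = "\<lambda>P. if P \<in> ?S then gibbs_weight w P / ?Z else 0"
  have pos: "gibbs_weight w Q > 0" if "Q \<in> ?S" for Q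
    unfolding gibbs_weight_def
  proof (intro prod_pos w)
    fix A assume A: "A \<in> Q"
    have Q: "partition_on {1..n} Q" using that by (simp add: partitions_into_def)
    have "A \<subseteq> {1..n}" "A \<noteq> {}"
      using partition_onD1[OF Q] partition_onD3[OF Q] A by blast+
    moreover from this have "finite A" by (meson finite_atLeastAtMost finite_subset)
    ultimately
    show "card A \<ge> 1" by (simp add: Suc_le_eq card_gt_0_iff)
  qed
  have Z: "?Z > 0"
    using finite_partitions_into partitions_into_nonempty[OF k] pos by (intro sum_pos)
  have nonneg: "0 \<le> ?f P" for P using pos Z by (auto intro!: divide_nonneg_pos less_imp_le)
  have "(\<integral>\<^sup>+ P. ennreal (?f P) \<partial>count_space UNIV) = (\<Sum>P\<in>?S. ennreal (?f P))"
    by (rule nn_integral_count_space'[OF finite_partitions_into]) auto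
  also have "\<dots> = ennreal (\<Sum>P\<in>?S. ?f P)"
    using nonneg by (intro sum_ennreal)
  also have "(\<Sum>P\<in>?S. ?f P) = 1"
    using Z by (simp add: sum_divide_distrib[symmetric])
  finally have "(\<integral>\<^sup>+ P. ennreal (?f P) \<partial>count_space UNIV) = 1" by simp
  then show ?thesis
    unfolding gibbs_pmf_def by (subst pmf_embed_pmf) (use nonneg in auto)
qed

end

theory Submission
  imports Defs
begin

text \<open>
  The partition is revealed one element at a time. Let \<open>T(n, k)\<close> be the total weight of the
  partitions of \<open>{1..n}\<close> into \<open>k\<close> blocks and \<open>a(n, k) = n - \<alpha> k\<close> (\<open>k\<close> if \<open>\<alpha> = -\<infinity>\<close>). Inserting
  \<open>n + 1\<close> as a singleton or into an existing block gives
  \<open>T(n + 1, k) = T(n, k - 1) + a(n, k) T(n, k)\<close>, and given \<open>K = k\<close> the element \<open>n + 1\<close> is a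
  singleton with probability \<open>p(n, k) = T(n, k - 1) / T(n + 1, k)\<close>; the other indicators then
  follow the law for \<open>n\<close> with \<open>k - 1\<close> resp. \<open>k\<close> blocks. If \<open>p(n, k)\<close> increases in \<open>k\<close>, one
  independent threshold decides this simultaneously for all \<open>k\<close>, and a monotone coupling for \<open>n\<close>
  extends to \<open>n + 1\<close>.

  Monotonicity of \<open>p = R / (1 + R)\<close> is that of \<open>R(n, k) = T(n, k - 1) / (a(n, k) T(n, k))\<close>, which
  satisfies \<open>R(n + 1, k) = c(n, k) R(n, k) (1 + R(n, k - 1)) / (1 + R(n, k))\<close> with
  \<open>c(n, k) = a(n, k - 1) / a(n + 1, k)\<close>. The invariants that induction along this recursion
  carries are stronger than monotonicity: \<open>R(n, k) \<le> (k - 1) / (n - k + 2)\<close> and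
  \<open>R(n, k + 1) \<ge> (1 + (1 / k + 1 / (n - k)) / 2) R(n, k)\<close>.
\<close>

section \<open>Real inequalities behind the ratio recursion\<close>

text \<open>The growth factor of the second invariant, with \<open>d\<close> in the role of
  \<open>n - k\<close>.\<close>

definition ratio_gap :: "real \<Rightarrow> real \<Rightarrow> real" where
  "ratio_gap d k = 1 + (1 / k + 1 / d) / 2"

text \<open>Replaces a quadratic inequality on the interval from \<open>0\<close> to
  \<open>u / v\<close> by three sign conditions free of \<open>r\<close>; for polynomial data these
  can be settled by expansion.\<close>

lemma quadratic_nonneg_below:
  fixes A B C r u v :: real
  assumes "0 \<le> C" "0 \<le> B * u + 2 * C * v" "0 \<le> A * u\<^sup>2 + B * u * v + C * v\<^sup>2"
    and "0 \<le> r" "r * v \<le> u" "0 < u" "0 < v"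
  shows "0 \<le> A * r\<^sup>2 + B * r + C"
proof (cases "r = 0")
  case False
  \<comment> \<open>With \<open>r = u / (v + z)\<close> the assumptions bound the coefficients of the powers of \<open>z\<close>.\<close>
  define z where "z = u / r - v"
  have r: "0 < r" using False assms by simp
  have z: "0 \<le> z" using r assms by (simp add: z_def field_simps)
  have u: "u = r * (v + z)" using r by (simp add: z_def)
  have "0 \<le> (A * u\<^sup>2 + B * u * v + C * v\<^sup>2) + (B * u + 2 * C * v) * z + C * z\<^sup>2"
    using assms z by simp
  also have "\<dots> = (A * r\<^sup>2 + B * r + C) * (v + z)\<^sup>2"
    unfolding u by (simp add: power2_eq_square algebra_simps)
  finally show ?thesis
    using assms z by (simp add: zero_le_mult_iff)
qed (use assms in simp)

text \<open>The extremal case of \<open>ratio_gap_step\<close>, with common factors cancelled: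
  \<open>x\<close> and \<open>z\<close> sit at the bounds given by the gap invariant and
  \<open>c' = e * c\<close>. The bound on \<open>r\<close> is the first invariant for
  \<open>R(n, k)\<close> with \<open>n = d + k\<close>.\<close>

lemma ratio_gap_quadratic:
  fixes d k r :: real
  assumes "1 \<le> d" "2 \<le> k" "0 \<le> r" "r * (d + 2) \<le> k - 1"
  defines "e \<equiv> 1 - 1 / (4 * d * (d + k))"
  shows "ratio_gap (d + 1) k * (1 + ratio_gap d k * r) * (1 + r / ratio_gap (d + 1) (k - 1))
    \<le> e * ratio_gap d k * (1 + r)\<^sup>2"
proof -
  define m where "m = d + k"
  \<comment> \<open>Numerators and denominators of the three gap factors and of \<open>e\<close>, so
    that only polynomials remain.\<close>
  define gn gd pn pd hn hd en ed where defs: "gn = 2*k*d+m" "gd = 2*k*d"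
    "pn = 2*k*(d+1)+m+1" "pd = 2*k*(d+1)" "hn = 2*(k-1)*(d+1)+m" "hd = 2*(k-1)*(d+1)"
    "en = 4*d*m-1" "ed = 4*d*m"
  have pos: "gd > 0" "pd > 0" "hd > 0" "ed > 0" "hn > 0"
    using assms by (auto simp: defs m_def intro!: mult_pos_pos add_pos_pos)
  \<comment> \<open>Coefficients in \<open>r\<close> of the right side minus the left side,
    multiplied by \<open>gd * ed * pd * hn\<close>.\<close>
  define A where "A = gn*en*pd*hn - pn*gn*hd*ed"
  define B where "B = 2*(gn*en*pd*hn) - pn*(gn*hn+gd*hd)*ed"
  define C where "C = gn*en*pd*hn - pn*gd*ed*hn"
  \<comment> \<open>In \<open>D = d - 1\<close> and \<open>K = k - 2\<close> the three polynomials below have nonnegative coefficients.\<close>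
  obtain D K where DK: "d = D + 1" "k = K + 2" "0 \<le> D" "0 \<le> K"
    using assms by (metis add.commute diff_add_cancel diff_ge_0_iff_ge)
  have "0 \<le> A * r\<^sup>2 + B * r + C"
  proof (rule quadratic_nonneg_below)
    show "0 \<le> C"
      unfolding C_def defs m_def DK using DK(3,4)
      by (simp add: algebra_simps)
    show "0 \<le> B * (k - 1) + 2 * C * (d + 2)"
      unfolding B_def C_def defs m_def DK using DK(3,4)
      by (simp add: algebra_simps)
    show "0 \<le> A * (k - 1)\<^sup>2 + B * (k - 1) * (d + 2) + C * (d + 2)\<^sup>2"
      unfolding A_def B_def C_def defs m_def DK using DK(3,4)
      by (simp add: algebra_simps power2_eq_square)
  qed (use assms in auto)
  have 1: "ratio_gap d k = gn / gd" "ratio_gap (d + 1) k = pn / pd"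
    "ratio_gap (d + 1) (k - 1) = hn / hd" "e = en / ed"
    using pos assms(1,2) unfolding ratio_gap_def e_def
    by (simp_all add: eq_divide_eq distrib_right divide_simps)
      (simp_all add: defs m_def algebra_simps)
  have "e * ratio_gap d k * (1 + r)\<^sup>2 - ratio_gap (d + 1) k * (1 + ratio_gap d k * r) * (1 + r / ratio_gap (d + 1) (k - 1)) = (A * r\<^sup>2 + B * r + C) / (gd * ed * pd * hn)"
    unfolding 1 A_def B_def C_def using pos by (simp add: field_simps power2_eq_square)
  with \<open>0 \<le> A * r\<^sup>2 + B * r + C\<close> pos show ?thesis
    by (smt (verit) divide_nonneg_pos mult_pos_pos)
qed

lemma saturation_mono:
  fixes x y :: real
  assumes "0 \<le> x" "x \<le> y"
  shows "x / (1 + x) \<le> y / (1 + y)"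
  using assms by (simp add: frac_le_eq divide_simps) (simp add: algebra_simps)

lemma ratio_gap_ge_1: "0 < d \<Longrightarrow> 0 < k \<Longrightarrow> 1 \<le> ratio_gap d k"
  by (simp add: ratio_gap_def)

text \<open>Induction step of the gap invariant at \<open>n = d + k\<close>: \<open>x\<close>,
  \<open>y\<close>, \<open>z\<close> are the ratios at \<open>k - 1\<close>, \<open>k\<close>,
  \<open>k + 1\<close>. The left side increases in \<open>x\<close>, the right side in
  \<open>z\<close> and \<open>c'\<close>, so each is replaced by its bound.\<close>

lemma ratio_gap_step:
  fixes d k x y z c c' :: real
  assumes "1 \<le> d" "2 \<le> k" "0 \<le> x" "0 \<le> y" "y * (d + 2) \<le> k - 1"
    and xy: "x * ratio_gap (d + 1) (k - 1) \<le> y" and yz: "ratio_gap d k * y \<le> z"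
    and c: "0 \<le> c" "(1 - 1 / (4 * d * (d + k))) * c \<le> c'"
  shows "ratio_gap (d + 1) k * (c * (y * (1 + x) / (1 + y))) \<le> c' * (z * (1 + y) / (1 + z))"
proof -
  define g g' h e where defs: "g = ratio_gap d k" "g' = ratio_gap (d + 1) k"
    "h = ratio_gap (d + 1) (k - 1)" "e = 1 - 1 / (4 * d * (d + k))"
  have g: "1 \<le> g" "1 \<le> g'" "1 \<le> h"
    using assms unfolding defs by (auto intro!: ratio_gap_ge_1)
  have "1 * 1 \<le> 4 * d * (d + k)" using assms by (intro mult_mono) auto
  then have e: "0 \<le> e" by (simp add: defs divide_le_eq_1)
  have x: "x \<le> y / h" using xy g by (simp add: defs field_simps)
  have gy: "0 \<le> g * y" using g assms by simp
  have K: "g' * (1 + g * y) * (1 + y / h) \<le> e * g * (1 + y)\<^sup>2"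
    unfolding defs by (rule ratio_gap_quadratic) (use assms in auto)
  have "g' * (c * (y * (1 + x) / (1 + y))) \<le> g' * (c * (y * (1 + y / h) / (1 + y)))"
    using x g assms by (intro mult_left_mono divide_right_mono) auto
  also have "\<dots> = (c * y / ((1 + y) * (1 + g * y))) * (g' * (1 + g * y) * (1 + y / h))"
    using gy by simp
  also have "\<dots> \<le> (c * y / ((1 + y) * (1 + g * y))) * (e * g * (1 + y)\<^sup>2)"
    using K assms gy by (intro mult_left_mono) auto
  also have "\<dots> = (e * c) * (1 + y) * (g * y / (1 + g * y))"
    using \<open>0 \<le> y\<close> gy by (simp add: power2_eq_square)
  also have "\<dots> \<le> (e * c) * (1 + y) * (z / (1 + z))"
    using e c assms gy yz by (intro mult_left_mono saturation_mono) (auto simp: defs)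
  also have "\<dots> \<le> c' * (1 + y) * (z / (1 + z))"
    using c(2) gy yz assms by (intro mult_right_mono) (auto simp: defs)
  finally show ?thesis by (simp add: defs mult_ac)
qed

text \<open>Three inductions on \<open>m\<close> prove nonnegativity, the upper bound and the gap.
  Column \<open>1\<close> and the diagonal are boundary values; \<open>R_Suc\<close> covers the
  entries between.\<close>

lemma ratio_recursion_mono:
  fixes R c :: "nat \<Rightarrow> nat \<Rightarrow> real"
  assumes R_1: "\<And>m. 1 \<le> m \<Longrightarrow> R m 1 = 0"
    and R_diag: "\<And>m. 1 \<le> m \<Longrightarrow> R m m = (real m - 1) / 2"
    and R_Suc: "\<And>m k. 2 \<le> k \<Longrightarrow> k \<le> m \<Longrightarrow>
      R (Suc m) k = c m k * (R m k * (1 + R m (k - 1)) / (1 + R m k))"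
    and c_bounds: "\<And>m k. 2 \<le> k \<Longrightarrow> k \<le> m \<Longrightarrow> 0 \<le> c m k \<and> c m k \<le> 1"
    and c_growth: "\<And>m k. 2 \<le> k \<Longrightarrow> k < m \<Longrightarrow>
      (1 - 1 / (4 * (real m - real k) * real m)) * c m k \<le> c m (Suc k)"
    and "1 \<le> k" "k < m"
  shows "R m k \<le> R m (Suc k)"
proof -
  have nonneg: "\<forall>k\<in>{1..m}. 0 \<le> R m k" if "1 \<le> m" for m
    using that
  proof (induction m rule: dec_induct)
    case base
    then show ?case by (simp add: R_diag)
  next
    case (step m)
    have "0 \<le> R (Suc m) k" if "2 \<le> k" "k \<le> m" for k
    proof -
      have "0 \<le> R m k" "0 \<le> R m (k - 1)"
        using that by (auto intro!: bspec[OF step.IH])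
      then show ?thesis
        unfolding R_Suc[OF that] using c_bounds[OF that] by simp
    qed
    moreover have "0 \<le> R (Suc m) 1" "0 \<le> R (Suc m) (Suc m)"
      using R_1[of "Suc m"] R_diag[of "Suc m"] by simp_all
    ultimately show ?case
      by (metis One_nat_def Suc_1 Suc_leI atLeastAtMost_iff le_SucE le_neq_implies_less)
  qed
  \<comment> \<open>For \<open>c = 1\<close> the bound \<open>(k - 1) / (m - k + 2)\<close> solves
    the recursion exactly, with equality in column \<open>1\<close> and on the diagonal. The
    recursion is increasing in both ratios and \<open>c \<le> 1\<close>, so the bound
    persists.\<close>
  have upper: "\<forall>k\<in>{1..m}. R m k * (real m - real k + 2) \<le> real k - 1" if "1 \<le> m" for m
    using that
  proof (induction m rule: dec_induct)
    case base
    then show ?case by (simp add: R_diag)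
  next
    case (step m)
    have "R (Suc m) k * (real (Suc m) - real k + 2) \<le> real k - 1" if k: "2 \<le> k" "k \<le> m" for k
    proof -
      define d where "d = real m - real k"
      have d: "0 \<le> d" using k by (simp add: d_def)
      define x y where "x = R m (k - 1)" and "y = R m k"
      have xy: "0 \<le> x" "0 \<le> y"
        using k unfolding x_def y_def by (auto intro!: bspec[OF nonneg[OF step(1)]])
      have "R m k * (real m - real k + 2) \<le> real k - 1"
        using step.IH k by auto
      then have y: "y \<le> (real k - 1) / (d + 2)"
        using d by (simp add: y_def d_def field_simps)
      have "R m (k - 1) * (real m - real (k - 1) + 2) \<le> real (k - 1) - 1"
        using k by (intro bspec[OF step.IH]) auto
      then have x: "x * (d + 3) \<le> real k - 2"
        using k by (simp add: x_def d_def of_nat_diff algebra_simps)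
      have "R (Suc m) k = c m k * (y * (1 + x) / (1 + y))"
        by (simp add: R_Suc k x_def y_def)
      also have "\<dots> \<le> 1 * (y * (1 + x) / (1 + y))"
        using c_bounds[OF k] xy by (intro mult_right_mono) auto
      also have "\<dots> = (1 + x) * (y / (1 + y))" by simp
      also have "\<dots> \<le> (1 + x) * (((real k - 1) / (d + 2)) / (1 + (real k - 1) / (d + 2)))"
        using xy y by (intro mult_left_mono saturation_mono) auto
      also have "\<dots> = (1 + x) * ((real k - 1) / (d + 1 + real k))"
        using d k by (simp add: divide_simps)
      finally have "R (Suc m) k * (d + 3) \<le> (1 + x) * ((real k - 1) / (d + 1 + real k)) * (d + 3)"
        using d by (intro mult_right_mono) auto
      also have "\<dots> = ((1 + x) * (d + 3)) * ((real k - 1) / (d + 1 + real k))"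
        by (simp only: mult_ac)
      also have "(1 + x) * (d + 3) = d + 3 + x * (d + 3)"
        by (simp add: algebra_simps)
      also have "(d + 3 + x * (d + 3)) * ((real k - 1) / (d + 1 + real k)) \<le>
          (d + 3 + (real k - 2)) * ((real k - 1) / (d + 1 + real k))"
        using x d k by (intro mult_right_mono) auto
      also have "\<dots> = real k - 1" using d k by (simp add: field_simps)
      finally show ?thesis by (simp add: d_def algebra_simps)
    qed
    moreover have "R (Suc m) 1 * (real (Suc m) - real 1 + 2) \<le> real 1 - 1"
      "R (Suc m) (Suc m) * (real (Suc m) - real (Suc m) + 2) \<le> real (Suc m) - 1"
      using R_1[of "Suc m"] R_diag[of "Suc m"] by simp_all
    ultimately show ?case
      by (metis One_nat_def Suc_1 Suc_leI atLeastAtMost_iff le_SucE le_neq_implies_less)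
  qed
  have gap: "\<forall>k\<in>{2..<m}. ratio_gap (real m - real k) (real k) * R m k \<le> R m (Suc k)" if "1 \<le> m" for m
    using that
  proof (induction m rule: dec_induct)
    case base
    then show ?case by simp
  next
    case (step m)
    show ?case
    proof
      fix k assume k: "k \<in> {2..<Suc m}"
      show "ratio_gap (real (Suc m) - real k) (real k) * R (Suc m) k \<le> R (Suc m) (Suc k)"
      proof (cases "k = m")
        \<comment> \<open>\<open>R (Suc m) (Suc k)\<close> is now on the diagonal, out of reach of
          \<open>R_Suc\<close>; its value \<open>m / 2\<close> is compared with the upper bound on
          \<open>R (Suc m) m\<close>.\<close>
        case True
        have "R (Suc m) m * (real (Suc m) - real m + 2) \<le> real m - 1"
          using upper[of "Suc m"] step(1) by (auto simp del: of_nat_Suc)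
        then have R: "R (Suc m) m \<le> (real m - 1) / 3" by simp
        have "ratio_gap 1 (real m) * R (Suc m) m \<le> ratio_gap 1 (real m) * ((real m - 1) / 3)"
          using R ratio_gap_ge_1[of 1 "real m"] step(1) by (intro mult_left_mono) auto
        also have "\<dots> \<le> real m / 2"
          using step(1) by (simp add: ratio_gap_def field_simps)
        finally show ?thesis using True by (simp add: R_diag)
      next
        case False
        with k have k: "2 \<le> k" "k < m" by auto
        define d where "d = real m - real k"
        have d: "1 \<le> d" using k by (simp add: d_def)
        have IH: "ratio_gap d (real k) * R m k \<le> R m (Suc k)"
          using step.IH k by (auto simp: d_def)
        have low: "R m (k - 1) * ratio_gap (d + 1) (real k - 1) \<le> R m k"
        \<comment> \<open>The gap hypothesis starts at column \<open>2\<close>; in column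
          \<open>1\<close> the ratio is zero.\<close>
        proof (cases "k = 2")
          case True
          then show ?thesis using nonneg[OF step(1)] R_1[OF step(1)] k by simp
        next
          case False
          then have "k - 1 \<in> {2..<m}" using k by auto
          from step.IH[rule_format, OF this] show ?thesis
            using k by (simp add: d_def of_nat_diff algebra_simps)
        qed
        have "ratio_gap (d + 1) (real k) * (c m k * (R m k * (1 + R m (k - 1)) / (1 + R m k)))
          \<le> c m (Suc k) * (R m (Suc k) * (1 + R m k) / (1 + R m (Suc k)))"
        proof (rule ratio_gap_step[OF d _ _ _ _ low IH])
          show "0 \<le> R m (k - 1)" "0 \<le> R m k"
            using k by (auto intro!: bspec[OF nonneg[OF step(1)]])
          show "R m k * (d + 2) \<le> real k - 1"
            using bspec[OF upper[OF step(1)], of k] k by (simp add: d_def)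
          show "(1 - 1 / (4 * d * (d + real k))) * c m k \<le> c m (Suc k)"
            using c_growth[OF k] by (simp add: d_def)
        qed (use k c_bounds[of k m] in auto)
        then show ?thesis
          using k by (simp add: R_Suc d_def algebra_simps)
      qed
    qed
  qed
  show ?thesis
  proof (cases "k = 1")
    case True
    then show ?thesis using nonneg[of m] R_1[of m] assms by simp
  next
    case False
    then have k: "2 \<le> k" using assms by simp
    have "1 * R m k \<le> ratio_gap (real m - real k) (real k) * R m k"
      using nonneg[of m] assms by (intro mult_right_mono ratio_gap_ge_1) auto
    also have "\<dots> \<le> R m (Suc k)"
      using gap[of m] k assms by auto
    finally show ?thesis by simp
  qed
qed

section \<open>Inserting the largest element into a set partition and removing it\<close>

lemma finite_partition_parts:
  assumes "P \<in> partitions_into n k"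
  shows "finite P" "\<And>A. A \<in> P \<Longrightarrow> finite A" "\<And>A. A \<in> P \<Longrightarrow> A \<noteq> {}" "\<And>A. A \<in> P \<Longrightarrow> A \<subseteq> {1..n}"
    "card P = k"
proof -
  have P: "partition_on {1..n} P" "card P = k" using assms by (auto simp: partitions_into_def)
  show "finite P" using finite_elements[OF _ P(1)] by simp
  show sub: "A \<subseteq> {1..n}" if "A \<in> P" for A using partition_onD1[OF P(1)] that by auto
  show "finite A" if "A \<in> P" for A using sub[OF that] finite_subset by blast
  show "A \<noteq> {}" if "A \<in> P" for A using partition_onD3[OF P(1)] that by auto
  show "card P = k" by fact
qed

lemma partitions_into_disjoint:
  assumes "P \<in> partitions_into n k" "A \<in> P" "B \<in> P" "x \<in> A" "x \<in> B"
  shows "A = B"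
  using assms partition_onD2[of "{1..n}" P] by (auto simp: partitions_into_def disjoint_def)

lemma partitions_into_add_singleton:
  assumes "P \<in> partitions_into n k"
  shows "insert {Suc n} P \<in> partitions_into (Suc n) (Suc k)" "{Suc n} \<notin> P"
proof -
  note P = finite_partition_parts[OF assms]
  show *: "{Suc n} \<notin> P" using P(4) by fastforce
  have part: "partition_on {1..n} P" using assms by (simp add: partitions_into_def)
  have "{1..Suc n} - {Suc n} = {1..n}" by auto
  moreover have "disjnt {Suc n} (\<Union>P)" using P(4) by (fastforce simp: disjnt_def)
  ultimately have "partition_on {1..Suc n} (insert {Suc n} P)"
    using part by (simp add: partition_on_insert)
  then show "insert {Suc n} P \<in> partitions_into (Suc n) (Suc k)"
    using P * by (simp add: partitions_into_def)
qed

lemma partitions_into_remove_singleton: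
  assumes "P \<in> partitions_into (Suc n) (Suc k)" "{Suc n} \<in> P"
  shows "P - {{Suc n}} \<in> partitions_into n k"
proof -
  note P = finite_partition_parts[OF assms(1)]
  have part: "partition_on {1..Suc n} (insert {Suc n} (P - {{Suc n}}))"
    using assms by (simp add: partitions_into_def insert_absorb)
  have "disjnt {Suc n} (\<Union>(P - {{Suc n}}))"
    using partitions_into_disjoint[OF assms(1,2)] by (auto simp: disjnt_def)
  from iffD1[OF partition_on_insert[OF this] part]
  have "partition_on ({1..Suc n} - {Suc n}) (P - {{Suc n}})" by blast
  moreover have "{1..Suc n} - {Suc n} = {1..n}" by auto
  ultimately show ?thesis using P assms by (simp add: partitions_into_def)
qed

lemma partitions_into_enlarge_block:
  assumes "P \<in> partitions_into n k" "A \<in> P"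
  shows "insert (insert (Suc n) A) (P - {A}) \<in> partitions_into (Suc n) k"
    "insert (Suc n) A \<notin> P" "Suc n \<notin> A"
proof -
  note P = finite_partition_parts[OF assms(1)]
  show A: "Suc n \<notin> A" using P(4)[OF assms(2)] by auto
  show *: "insert (Suc n) A \<notin> P" using P(4) by fastforce
  have part: "partition_on {1..n} (insert A (P - {A}))"
    using assms by (simp add: partitions_into_def insert_absorb)
  have "disjnt A (\<Union>(P - {A}))"
    using partitions_into_disjoint[OF assms(1,2)] by (auto simp: disjnt_def)
  from iffD1[OF partition_on_insert[OF this] part]
  have 1: "partition_on ({1..n} - A) (P - {A})" and 2: "A \<subseteq> {1..n}" by blast+
  have "disjnt (insert (Suc n) A) (\<Union>(P - {A}))"
    using 1 by (auto simp: disjnt_def partition_on_def)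
  moreover have "{1..Suc n} - insert (Suc n) A = {1..n} - A" by auto
  ultimately have "partition_on {1..Suc n} (insert (insert (Suc n) A) (P - {A}))"
    using 1 2 by (subst partition_on_insert) auto
  moreover have "card P \<noteq> 0" using assms(2) P(1) by auto
  ultimately show "insert (insert (Suc n) A) (P - {A}) \<in> partitions_into (Suc n) k"
    using P(1,5) assms(2) * by (simp add: partitions_into_def)
qed

lemma partitions_into_shrink_block:
  assumes "P \<in> partitions_into (Suc n) k" "insert (Suc n) A \<in> P" "Suc n \<notin> A" "A \<noteq> {}"
  shows "insert A (P - {insert (Suc n) A}) \<in> partitions_into n k" "A \<notin> P"
proof -
  note P = finite_partition_parts[OF assms(1)]
  let ?A = "insert (Suc n) A"
  obtain a where "a \<in> A" using assms by auto
  then show *: "A \<notin> P"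
    using partitions_into_disjoint[OF assms(1) assms(2), of A a] assms(3) by auto
  have part: "partition_on {1..Suc n} (insert ?A (P - {?A}))"
    using assms by (simp add: partitions_into_def insert_absorb)
  have "disjnt ?A (\<Union>(P - {?A}))"
    using partitions_into_disjoint[OF assms(1,2)] by (auto simp: disjnt_def)
  from iffD1[OF partition_on_insert[OF this] part]
  have 1: "partition_on ({1..Suc n} - ?A) (P - {?A})" and 2: "?A \<subseteq> {1..Suc n}" by blast+
  have "disjnt A (\<Union>(P - {?A}))"
    using 1 by (auto simp: disjnt_def partition_on_def)
  moreover have "{1..Suc n} - ?A = {1..n} - A" by auto
  moreover have "A \<subseteq> {1..n}" using 2 assms(3) by (auto simp: subset_iff le_Suc_eq)
  ultimately have "partition_on {1..n} (insert A (P - {?A}))"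
    using 1 assms(4) by (subst partition_on_insert) auto
  moreover have "card P \<noteq> 0" using assms(2) P(1) by auto
  ultimately show "insert A (P - {?A}) \<in> partitions_into n k"
    using P(1,5) assms(2) * by (simp add: partitions_into_def)
qed

text \<open>Partitions are split by whether \<open>{Suc n}\<close> is a block. If not, removing
  \<open>Suc n\<close> leaves a partition with a marked block, and the pair determines the
  original.\<close>

lemma sum_partitions_into_Suc:
  "(\<Sum>P\<in>partitions_into (Suc n) (Suc k). h P) =
    (\<Sum>P\<in>partitions_into n k. h (insert {Suc n} P)) +
    (\<Sum>P\<in>partitions_into n (Suc k). \<Sum>A\<in>P. h (insert (insert (Suc n) A) (P - {A})))"
  for h :: "nat set set \<Rightarrow> real"
proof -
  let ?X = "partitions_into (Suc n) (Suc k)"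
  let ?S = "{P \<in> ?X. {Suc n} \<in> P}" and ?T = "{P \<in> ?X. {Suc n} \<notin> P}"
  \<comment> \<open>The junk value of \<open>THE\<close> does not occur: each \<open>P\<close> in \<open>?X\<close> has exactly one such block.\<close>
  define blk where "blk P = (THE A. A \<in> P \<and> Suc n \<in> A)" for P
  have blk: "blk P = A" if "P \<in> ?X" "A \<in> P" "Suc n \<in> A" for P A
    unfolding blk_def using partitions_into_disjoint[OF that(1)] that by (intro the_equality) auto
  have blk_mem: "blk P \<in> P \<and> Suc n \<in> blk P" if "P \<in> ?X" for P
  proof -
    have "Suc n \<in> \<Union>P" using that by (auto simp: partitions_into_def partition_on_def)
    then obtain A where "A \<in> P" "Suc n \<in> A" by blast
    with blk[OF that this] show ?thesis by simp
  qed
  have blk_ne: "blk P - {Suc n} \<noteq> {}" if "P \<in> ?X" "{Suc n} \<notin> P" for P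
    using blk_mem[OF that(1)] that(2) by (metis Diff_eq_empty_iff empty_iff subset_singleton_iff)
  have "(\<Sum>P\<in>?X. h P) = (\<Sum>P\<in>?S. h P) + (\<Sum>P\<in>?T. h P)"
    by (subst sum.union_disjoint[symmetric])
      (auto intro!: sum.cong finite_subset[OF _ finite_partitions_into])
  also have "(\<Sum>P\<in>?S. h P) = (\<Sum>P\<in>partitions_into n k. h (insert {Suc n} P))"
    by (rule sum.reindex_bij_witness[where i = "insert {Suc n}" and j = "\<lambda>P. P - {{Suc n}}"])
      (auto simp: partitions_into_add_singleton partitions_into_remove_singleton insert_absorb)
  also have "(\<Sum>P\<in>?T. h P) = (\<Sum>(P, A)\<in>(SIGMA P:partitions_into n (Suc k). P).
      h (insert (insert (Suc n) A) (P - {A})))"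
  \<comment> \<open>The cases are, in order: \<open>i\<close> undoes \<open>j\<close>,
    \<open>j\<close> maps into the pairs, \<open>j\<close> undoes \<open>i\<close>, \<open>i\<close>
    maps into the partitions, and the summands agree.\<close>
  proof (rule sum.reindex_bij_witness[where i = "\<lambda>(P, A). insert (insert (Suc n) A) (P - {A})"
        and j = "\<lambda>P. (insert (blk P - {Suc n}) (P - {blk P}), blk P - {Suc n})"], goal_cases)
    case (1 P)
    then have P: "P \<in> ?X" "{Suc n} \<notin> P" by auto
    have A: "insert (Suc n) (blk P - {Suc n}) = blk P" using blk_mem[OF P(1)] by auto
    have "blk P - {Suc n} \<noteq> {}" by (rule blk_ne[OF P])
    from partitions_into_shrink_block[OF P(1) _ _ this] A blk_mem[OF P(1)]
    have "blk P - {Suc n} \<notin> P" by auto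
    then show ?case using A blk_mem[OF P(1)] by auto
  next
    case (2 P)
    then have P: "P \<in> ?X" "{Suc n} \<notin> P" by auto
    have A: "insert (Suc n) (blk P - {Suc n}) = blk P" using blk_mem[OF P(1)] by auto
    have "blk P - {Suc n} \<noteq> {}" by (rule blk_ne[OF P])
    from partitions_into_shrink_block[OF P(1) _ _ this] A blk_mem[OF P(1)]
    show ?case by auto
  next
    case (3 PA)
    obtain P A where PA: "PA = (P, A)" "P \<in> partitions_into n (Suc k)" "A \<in> P"
      using 3 by auto
    note E = partitions_into_enlarge_block[OF PA(2,3)]
    have "blk (insert (insert (Suc n) A) (P - {A})) = insert (Suc n) A"
      by (rule blk) (use E in auto)
    then show ?case using PA E by auto
  next
    case (4 PA)
    obtain P A where PA: "PA = (P, A)" "P \<in> partitions_into n (Suc k)" "A \<in> P"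
      using 4 by auto
    note E = partitions_into_enlarge_block[OF PA(2,3)]
    have "A \<noteq> {}" using finite_partition_parts[OF PA(2)] PA(3) by auto
    then have "{Suc n} \<noteq> insert (Suc n) A" using E(3) by auto
    moreover have "{Suc n} \<notin> P" using partitions_into_add_singleton(2)[OF PA(2)] .
    ultimately show ?case using PA E by auto
  next
    case (5 P)
    then have P: "P \<in> ?X" "{Suc n} \<notin> P" by auto
    have A: "insert (Suc n) (blk P - {Suc n}) = blk P" using blk_mem[OF P(1)] by auto
    have "blk P - {Suc n} \<noteq> {}" by (rule blk_ne[OF P])
    from partitions_into_shrink_block[OF P(1) _ _ this] A blk_mem[OF P(1)]
    have "blk P - {Suc n} \<notin> P" by auto
    then have "insert (insert (Suc n) (blk P - {Suc n})) (insert (blk P - {Suc n}) (P - {blk P}) - {blk P - {Suc n}}) = P"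
      using A blk_mem[OF P(1)] by auto
    then show ?case by simp
  qed
  also have "\<dots> = (\<Sum>P\<in>partitions_into n (Suc k). \<Sum>A\<in>P. h (insert (insert (Suc n) A) (P - {A})))"
    using finite_partition_parts(1) by (intro sum.Sigma[symmetric] finite_partitions_into) auto
  finally show ?thesis .
qed

lemma block_min_ind_add_singleton:
  assumes "P \<in> partitions_into n k"
  shows "restrict (block_min_ind (insert {Suc n} P)) {1..Suc n} =
    (restrict (block_min_ind P) {1..n})(Suc n := 1)"
proof (rule ext)
  fix i
  note P = finite_partition_parts[OF assms]
  show "restrict (block_min_ind (insert {Suc n} P)) {1..Suc n} i =
    ((restrict (block_min_ind P) {1..n})(Suc n := 1)) i"
    by (auto simp: restrict_def block_min_ind_def)
qed

text \<open>The block \<open>A\<close> is nonempty and its elements are below \<open>Suc n\<close>,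
  so its minimum does not change.\<close>

lemma block_min_ind_enlarge_block:
  assumes "P \<in> partitions_into n k" "A \<in> P"
  shows "restrict (block_min_ind (insert (insert (Suc n) A) (P - {A}))) {1..Suc n} =
    (restrict (block_min_ind P) {1..n})(Suc n := 0)"
proof (rule ext)
  fix i
  note P = finite_partition_parts[OF assms(1)]
  let ?Q = "insert (insert (Suc n) A) (P - {A})"
  obtain a where a: "a \<in> A" "a \<le> n" using P(3,4)[OF assms(2)] by fastforce
  have "\<not> (\<exists>B\<in>?Q. Suc n \<in> B \<and> (\<forall>j\<in>B. Suc n \<le> j))"
    using a P(4) by fastforce
  moreover have "(\<exists>B\<in>?Q. i \<in> B \<and> (\<forall>j\<in>B. i \<le> j)) \<longleftrightarrow> (\<exists>B\<in>P. i \<in> B \<and> (\<forall>j\<in>B. i \<le> j))"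
    if "i \<le> n"
    using that assms(2) by (cases "i \<in> A") auto
  ultimately show "restrict (block_min_ind ?Q) {1..Suc n} i =
    ((restrict (block_min_ind P) {1..n})(Suc n := 0)) i"
    by (auto simp: restrict_def block_min_ind_def le_Suc_eq)
qed

lemma sum_card_partition:
  assumes "P \<in> partitions_into n k"
  shows "(\<Sum>A\<in>P. card A) = n"
  using product_partition[of "{1..n}" P] assms finite_partition_parts(2)[OF assms]
  by (simp add: partitions_into_def)

lemma partitions_into_eq_empty:
  assumes "n < k"
  shows "partitions_into n k = {}"
proof (rule ccontr)
  assume "partitions_into n k \<noteq> {}"
  then obtain P where P: "P \<in> partitions_into n k" by blast
  have "card P = (\<Sum>A\<in>P. 1)" by simp
  also have "\<dots> \<le> (\<Sum>A\<in>P. card A)"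
    using finite_partition_parts[OF P] by (intro sum_mono) (simp add: Suc_le_eq card_gt_0_iff)
  finally show False
    using sum_card_partition[OF P] finite_partition_parts(5)[OF P] assms by simp
qed

lemma partitions_into_0:
  shows "partitions_into 0 0 = {{}}" "0 < n \<Longrightarrow> partitions_into n 0 = {}"
proof -
  show "partitions_into 0 0 = {{}}"
    by (auto simp: partitions_into_def partition_on_empty)
  show "partitions_into n 0 = {}" if "0 < n"
  proof (rule ccontr)
    assume "partitions_into n 0 \<noteq> {}"
    then obtain P where P: "P \<in> partitions_into n 0" by blast
    with finite_partition_parts[OF P] sum_card_partition[OF P] that show False by simp
  qed
qed

section \<open>Bernoulli laws, thresholds and images of the Gibbs law\<close>

lemma eq_bernoulli_pmf: "M = bernoulli_pmf (pmf M True)"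
proof (rule pmf_eqI)
  fix b
  show "pmf M b = pmf (bernoulli_pmf (pmf M True)) b"
    by (cases b) (simp_all add: pmf_nonneg pmf_le_1 pmf_False_conv_True)
qed

text \<open>\<open>J\<close> has distribution function \<open>p\<close>. It charges only points
  where \<open>p\<close> jumps, which later keeps the coupling away from meaningless block
  numbers.\<close>

lemma threshold_pmf_exists:
  fixes p :: "nat \<Rightarrow> real"
  assumes p: "\<And>k. p k \<le> p (Suc k)" "p 0 = 0" "\<And>k. N \<le> k \<Longrightarrow> p k = 1"
  obtains J where "\<And>k. map_pmf (\<lambda>j. j \<le> k) J = bernoulli_pmf (p k)"
    "\<And>j. j \<in> set_pmf J \<Longrightarrow> p (j - 1) < p j"
proof
  \<comment> \<open>\<open>f 0 = 0\<close> because \<open>0 - 1 = 0\<close> on the naturals, in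
    agreement with \<open>p 0 = 0\<close>.\<close>
  define f where "f j = p j - p (j - 1)" for j
  have f: "0 \<le> f j" for j
    using p(1)[of "j - 1"] by (cases j) (auto simp: f_def)
  have sum_f: "(\<Sum>j\<le>k. f j) = p k" for k
    by (induction k) (auto simp: f_def p(2))
  have "f j = 0" if "j \<notin> {..N}" for j
    using that by (simp add: f_def p(3))
  then have "(\<integral>\<^sup>+ j. ennreal (f j) \<partial>count_space UNIV) = (\<Sum>j\<in>{..N}. ennreal (f j))"
    by (intro nn_integral_count_space') auto
  also have "\<dots> = 1" using f by (simp add: sum_ennreal sum_f p(3))
  finally have pmf_J: "pmf (embed_pmf f) j = f j" for j
    by (intro pmf_embed_pmf f)
  show "map_pmf (\<lambda>j. j \<le> k) (embed_pmf f) = bernoulli_pmf (p k)" for k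
  proof -
    have "pmf (map_pmf (\<lambda>j. j \<le> k) (embed_pmf f)) True = measure (embed_pmf f) {..k}"
      by (simp add: pmf_map vimage_def atMost_def)
    also have "\<dots> = p k"
      by (subst measure_measure_pmf_finite) (simp_all add: pmf_J sum_f)
    finally show ?thesis using eq_bernoulli_pmf by metis
  qed
  show "p (j - 1) < p j" if "j \<in> set_pmf (embed_pmf f)" for j
    using that f[of j] by (simp add: set_pmf_iff pmf_J f_def)
qed

lemma pmf_bernoulli_bind:
  assumes "0 \<le> p" "p \<le> 1"
  shows "pmf (bernoulli_pmf p \<bind> f) x = p * pmf (f True) x + (1 - p) * pmf (f False) x"
  using assms by (simp add: pmf_bind)

lemma pmf_map_gibbs_pmf:
  assumes "\<And>j. j \<ge> 1 \<Longrightarrow> w j > 0" "1 \<le> k" "k \<le> n"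
  shows "pmf (map_pmf f (gibbs_pmf w n k)) v =
    (\<Sum>P\<in>partitions_into n k. gibbs_weight w P * of_bool (f P = v)) /
    (\<Sum>P\<in>partitions_into n k. gibbs_weight w P)"
proof -
  note pmf_g = pmf_gibbs_pmf[where w = w, OF assms]
  let ?S = "partitions_into n k" and ?Z = "\<Sum>P\<in>partitions_into n k. gibbs_weight w P"
  have "set_pmf (gibbs_pmf w n k) \<subseteq> ?S"
    by (auto simp: set_pmf_iff pmf_g split: if_splits)
  then have "pmf (map_pmf f (gibbs_pmf w n k)) v = measure (gibbs_pmf w n k) {P \<in> ?S. f P = v}"
    unfolding pmf_map by (intro measure_pmf.finite_measure_eq_AE) (auto simp: AE_measure_pmf_iff)
  also have "\<dots> = (\<Sum>P\<in>{P \<in> ?S. f P = v}. gibbs_weight w P / ?Z)"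
    by (subst measure_measure_pmf_finite) (auto simp: finite_partitions_into pmf_g)
  also have "\<dots> = (\<Sum>P\<in>?S. gibbs_weight w P / ?Z * of_bool (f P = v))"
    by (intro sum.mono_neutral_cong_left) (auto simp: finite_partitions_into)
  finally show ?thesis by (simp add: sum_divide_distrib)
qed

section \<open>Totals and ratios of Gibbs weights\<close>

text \<open>
  Here \<open>b j = j - \<alpha>\<close> and \<open>a n k = n - \<alpha> k\<close>, or \<open>b j = 1\<close> and \<open>a n k = k\<close> if \<open>\<alpha> = -\<infinity>\<close>. The last
  assumption is \<open>(1 - 1 / (4 (n - k) n)) c n k \<le> c n (Suc k)\<close> for the factors
  \<open>c n k = a n (k - 1) / a (Suc n) k\<close> of the ratio recursion, with the denominators cleared.
\<close>

locale gibbs_recursion =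
  fixes w b :: "nat \<Rightarrow> real" and a :: "nat \<Rightarrow> nat \<Rightarrow> real"
  assumes w_1: "w 1 = 1"
    and w_Suc: "1 \<le> j \<Longrightarrow> w (Suc j) = b j * w j"
    and b_pos: "1 \<le> j \<Longrightarrow> 0 < b j"
    and sum_b: "P \<in> partitions_into n k \<Longrightarrow> (\<Sum>A\<in>P. b (card A)) = a n k"
    and a_diag: "a n n = real n * b 1"
    and a_step: "1 \<le> k \<Longrightarrow> k \<le> n \<Longrightarrow> a n k \<le> a (Suc n) (Suc k)"
    and a_growth: "2 \<le> k \<Longrightarrow> k < n \<Longrightarrow>
      (4 * (real n - real k) * real n - 1) * (a n (k - 1) * a (Suc n) (Suc k)) \<le>
      4 * (real n - real k) * real n * (a n k * a (Suc n) k)"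
begin

lemma w_pos: "1 \<le> j \<Longrightarrow> 0 < w j"
  by (induction j rule: dec_induct) (simp_all add: w_1[simplified] w_Suc b_pos)

lemma gibbs_weight_pos:
  assumes "P \<in> partitions_into n k"
  shows "0 < gibbs_weight w P"
  using finite_partition_parts[OF assms] unfolding gibbs_weight_def
  by (intro prod_pos) (simp add: w_pos Suc_le_eq card_gt_0_iff)

lemma gibbs_weight_add_singleton:
  assumes "P \<in> partitions_into n k"
  shows "gibbs_weight w (insert {Suc n} P) = gibbs_weight w P"
  using partitions_into_add_singleton(2)[OF assms] finite_partition_parts(1)[OF assms] w_1
  by (simp add: gibbs_weight_def)

lemma gibbs_weight_enlarge_block:
  assumes "P \<in> partitions_into n k" "A \<in> P"
  shows "gibbs_weight w (insert (insert (Suc n) A) (P - {A})) = b (card A) * gibbs_weight w P"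
proof -
  note P = finite_partition_parts[OF assms(1)] and E = partitions_into_enlarge_block[OF assms]
  have "gibbs_weight w P = w (card A) * (\<Prod>B\<in>P - {A}. w (card B))"
    unfolding gibbs_weight_def by (rule prod.remove) (use P assms in auto)
  moreover have "1 \<le> card A" using P assms(2) by (simp add: Suc_le_eq card_gt_0_iff)
  ultimately show ?thesis
    using P(1) P(2)[OF assms(2)] E by (simp add: gibbs_weight_def w_Suc)
qed

text \<open>By \<open>sum_b\<close>, \<open>a n k\<close> is a sum of positive terms over the blocks
  of any one partition.\<close>

lemma a_pos:
  assumes "1 \<le> k" "k \<le> n"
  shows "0 < a n k"
proof -
  obtain P where P: "P \<in> partitions_into n k" using partitions_into_nonempty[OF assms] by blast
  note F = finite_partition_parts[OF P]
  have "P \<noteq> {}" using F assms by auto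
  then show ?thesis
    unfolding sum_b[OF P, symmetric] using F
    by (intro sum_pos b_pos) (auto simp: Suc_le_eq card_gt_0_iff)
qed

definition total :: "nat \<Rightarrow> nat \<Rightarrow> real" where
  "total n k = (\<Sum>P\<in>partitions_into n k. gibbs_weight w P)"

lemma total_pos: "1 \<le> k \<Longrightarrow> k \<le> n \<Longrightarrow> 0 < total n k"
  unfolding total_def
  using finite_partitions_into partitions_into_nonempty gibbs_weight_pos by (intro sum_pos)

lemma total_eq_0: "n < k \<Longrightarrow> total n k = 0" "0 < n \<Longrightarrow> total n 0 = 0"
  by (simp_all add: total_def partitions_into_eq_empty partitions_into_0)

text \<open>By \<open>sum_b\<close> the factors for joining a block add up to the same
  \<open>a n (Suc k)\<close> for every partition, so they leave the sum. Constant \<open>h\<close>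
  gives the recursion for \<open>total\<close>, an indicator the one for the law.\<close>

lemma weighted_sum_Suc:
  "(\<Sum>P\<in>partitions_into (Suc n) (Suc k). gibbs_weight w P * h (restrict (block_min_ind P) {1..Suc n})) =
    (\<Sum>P\<in>partitions_into n k. gibbs_weight w P * h ((restrict (block_min_ind P) {1..n})(Suc n := 1))) +
    a n (Suc k) * (\<Sum>P\<in>partitions_into n (Suc k).
      gibbs_weight w P * h ((restrict (block_min_ind P) {1..n})(Suc n := 0)))"
  (is "_ = ?X + a n (Suc k) * (\<Sum>P\<in>?S. ?g P)")
proof -
  have "(\<Sum>P\<in>?S. \<Sum>A\<in>P. gibbs_weight w (insert (insert (Suc n) A) (P - {A})) *
      h (restrict (block_min_ind (insert (insert (Suc n) A) (P - {A}))) {1..Suc n})) =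
    (\<Sum>P\<in>?S. \<Sum>A\<in>P. b (card A) * ?g P)"
    by (intro sum.cong refl)
      (simp add: gibbs_weight_enlarge_block block_min_ind_enlarge_block del: One_nat_def)
  also have "\<dots> = (\<Sum>P\<in>?S. a n (Suc k) * ?g P)"
    by (intro sum.cong refl) (simp only: sum_distrib_right[symmetric] sum_b)
  finally show ?thesis
    by (simp add: sum_partitions_into_Suc sum_distrib_left gibbs_weight_add_singleton
        block_min_ind_add_singleton del: One_nat_def)
qed

lemma total_Suc: "total (Suc n) (Suc k) = total n k + a n (Suc k) * total n (Suc k)"
  using weighted_sum_Suc[where h = "\<lambda>_. 1"] by (simp add: total_def)

lemma total_diag: "total n n = 1"
  by (induction n) (simp_all add: total_Suc total_eq_0, simp add: total_def partitions_into_0 gibbs_weight_def)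

text \<open>One block is a pair, of weight \<open>w 2 = b 1\<close>, and the others are singletons;
  there are \<open>n (n + 1) / 2\<close> pairs.\<close>

lemma total_subdiag: "total (Suc n) n = b 1 * (real n * (real n + 1) / 2)"
proof (induction n)
  case (Suc n)
  then show ?case
    by (simp add: total_Suc[of "Suc n"] total_diag a_diag field_simps)
qed (simp add: total_eq_0)

text \<open>The odds, given \<open>k\<close> blocks, of \<open>n + 1\<close> being a singleton
  against its joining another block.\<close>

definition ratio :: "nat \<Rightarrow> nat \<Rightarrow> real" where
  "ratio n k = total n (k - 1) / (a n k * total n k)"

lemma total_nonneg: "0 \<le> total n k"
  unfolding total_def using gibbs_weight_pos by (intro sum_nonneg) (auto intro: less_imp_le)

lemma ratio_nonneg: "1 \<le> k \<Longrightarrow> k \<le> n \<Longrightarrow> 0 \<le> ratio n k"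
  using a_pos[of k n] total_pos[of k n] by (simp add: ratio_def total_nonneg)

lemma total_Suc_eq_ratio:
  assumes "1 \<le> k" "k \<le> n"
  shows "total (Suc n) k = a n k * total n k * (1 + ratio n k)"
proof -
  obtain j where "k = Suc j" using assms by (cases k) auto
  then show ?thesis
    using a_pos[OF assms] total_pos[OF assms] by (simp add: total_Suc ratio_def field_simps)
qed

text \<open>Applying \<open>total_Suc_eq_ratio\<close> at \<open>k - 1\<close> and at
  \<open>k\<close> turns the recursion for \<open>total\<close> into the one that
  \<open>ratio_recursion_mono\<close> needs.\<close>

lemma ratio_mono:
  assumes "1 \<le> k" "k < n"
  shows "ratio n k \<le> ratio n (Suc k)"
proof (rule ratio_recursion_mono[where c = "\<lambda>n k. a n (k - 1) / a (Suc n) k", OF _ _ _ _ _ assms])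
  show "ratio m 1 = 0" if "1 \<le> m" for m
    using that by (simp add: ratio_def total_eq_0)
  show "ratio m m = (real m - 1) / 2" if m: "1 \<le> m" for m
  proof -
    obtain j where j: "m = Suc j" using m by (cases m) auto
    have "total m (m - 1) = (real j / 2) * (real m * b 1)"
      by (simp add: total_subdiag j algebra_simps)
    then have "ratio m m = (real j / 2) * (real m * b 1) / (real m * b 1)"
      by (simp only: ratio_def total_diag a_diag mult_1_right)
    also have "\<dots> = real j / 2"
      using m b_pos[of 1] by (intro nonzero_mult_div_cancel_right) auto
    finally show ?thesis by (simp add: j)
  qed
  show "ratio (Suc m) k = a m (k - 1) / a (Suc m) k *
      (ratio m k * (1 + ratio m (k - 1)) / (1 + ratio m k))" if "2 \<le> k" "k \<le> m" for m k
  proof -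
    have pos: "0 < a m k" "0 < total m k" "0 < 1 + ratio m k"
      using that a_pos[of k m] total_pos[of k m] ratio_nonneg[of k m] by auto
    have "ratio (Suc m) k = total (Suc m) (k - 1) / (a (Suc m) k * total (Suc m) k)"
      by (simp add: ratio_def)
    also have "\<dots> = (a m (k - 1) * total m (k - 1) * (1 + ratio m (k - 1))) /
        (a (Suc m) k * (a m k * total m k * (1 + ratio m k)))"
      using that by (simp add: total_Suc_eq_ratio)
    also have "total m (k - 1) = a m k * total m k * ratio m k"
      using pos by (simp add: ratio_def)
    finally show ?thesis using pos by simp
  qed
  show "0 \<le> a m (k - 1) / a (Suc m) k \<and> a m (k - 1) / a (Suc m) k \<le> 1"
    if "2 \<le> k" "k \<le> m" for m k
  proof -
    \<comment> \<open>With \<open>k = Suc j\<close> the bound by \<open>1\<close> is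
      \<open>a_step\<close> at \<open>j\<close>.\<close>
    obtain j where "k = Suc j" "1 \<le> j" using \<open>2 \<le> k\<close> by (cases k) auto
    then show ?thesis
      using that a_pos[of j m] a_pos[of k "Suc m"] a_step[of j m] by simp
  qed
  show "(1 - 1 / (4 * (real m - real k) * real m)) * (a m (k - 1) / a (Suc m) k)
      \<le> a m (Suc k - 1) / a (Suc m) (Suc k)" if "2 \<le> k" "k < m" for m k
  proof -
    define D where "D = 4 * (real m - real k) * real m"
    have D: "0 < D" using that by (simp add: D_def)
    have pos: "0 < a (Suc m) k" "0 < a (Suc m) (Suc k)" using that by (auto intro!: a_pos)
    have "(D - 1) * (a m (k - 1) * a (Suc m) (Suc k)) \<le> D * (a m k * a (Suc m) k)"
      using a_growth[OF that] by (simp only: D_def)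
    then have "(D - 1) * a m (k - 1) / (D * a (Suc m) k) \<le> a m k / a (Suc m) (Suc k)"
      using D pos by (simp add: frac_le_eq divide_le_0_iff field_simps)
    moreover have "(1 - 1 / D) * (a m (k - 1) / a (Suc m) k) = (D - 1) * a m (k - 1) / (D * a (Suc m) k)"
      using D by (simp add: field_simps)
    ultimately show ?thesis by (simp add: D_def)
  qed
qed

section \<open>The conditional probability of a new block and the monotone coupling\<close>

text \<open>The values at \<open>0\<close> and beyond \<open>n\<close> make this a distribution
  function in \<open>k\<close>; at \<open>k = n + 1\<close> the value \<open>1\<close> is the true
  probability.\<close>

definition new_prob :: "nat \<Rightarrow> nat \<Rightarrow> real" where
  "new_prob n k = (if k = 0 then 0 else if n < k then 1 else total n (k - 1) / total (Suc n) k)"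

lemma new_prob_eq_ratio:
  assumes "1 \<le> k" "k \<le> n"
  shows "new_prob n k = ratio n k / (1 + ratio n k)"
proof -
  have pos: "0 < a n k" "0 < total n k" "0 < 1 + ratio n k"
    using assms a_pos total_pos ratio_nonneg[of k n] by auto
  have "new_prob n k = total n (k - 1) / (a n k * total n k * (1 + ratio n k))"
    using assms by (simp add: new_prob_def total_Suc_eq_ratio)
  also have "total n (k - 1) = a n k * total n k * ratio n k"
    using pos by (simp add: ratio_def)
  finally show ?thesis using pos by simp
qed

lemma new_prob_bounds: "0 \<le> new_prob n k" "new_prob n k \<le> 1"
proof -
  have "0 \<le> new_prob n k \<and> new_prob n k \<le> 1"
  proof (cases "1 \<le> k \<and> k \<le> n")
    case True
    then have "0 \<le> ratio n k" by (simp add: ratio_nonneg)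
    with True show ?thesis by (simp add: new_prob_eq_ratio)
  qed (auto simp: new_prob_def)
  then show "0 \<le> new_prob n k" "new_prob n k \<le> 1" by auto
qed

lemma new_prob_mono:
  "new_prob n k \<le> new_prob n (Suc k)"
proof (cases "1 \<le> k \<and> k < n")
  case True
  then have "ratio n k / (1 + ratio n k) \<le> ratio n (Suc k) / (1 + ratio n (Suc k))"
    by (intro saturation_mono ratio_nonneg ratio_mono) auto
  with True show ?thesis by (simp add: new_prob_eq_ratio)
next
  case False
  then consider "k = 0" | "n \<le> k" by linarith
  then show ?thesis
  proof cases
    case 1
    then have "new_prob n k = 0" by (simp add: new_prob_def)
    then show ?thesis by (simp add: new_prob_bounds)
  next
    case 2
    then have "new_prob n (Suc k) = 1" by (simp add: new_prob_def)
    then show ?thesis by (simp add: new_prob_bounds)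
  qed
qed

text \<open>Conditioning on whether \<open>Suc n\<close> is a singleton. For \<open>k = 1\<close> or
  \<open>k = Suc n\<close> one of the two laws is an unspecified value of \<open>embed_pmf\<close>,
  but its coefficient is zero.\<close>

lemma block_min_law_Suc:
  assumes "1 \<le> n" "1 \<le> k" "k \<le> Suc n"
  shows "block_min_law w (Suc n) k = bernoulli_pmf (new_prob n k) \<bind> (\<lambda>new.
    if new then map_pmf (\<lambda>v. v(Suc n := 1)) (block_min_law w n (k - 1))
    else map_pmf (\<lambda>v. v(Suc n := 0)) (block_min_law w n k))"
proof (rule pmf_eqI)
  fix v
  obtain j where j: "k = Suc j" using assms by (cases k) auto
  define S where "S n k f = (\<Sum>P\<in>partitions_into n k. gibbs_weight w P *
    of_bool (f (restrict (block_min_ind P) {1..n}) = v))" for n k and f :: "(nat \<Rightarrow> nat) \<Rightarrow> nat \<Rightarrow> nat"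
  have law: "pmf (map_pmf f (block_min_law w n k)) v = S n k f / total n k"
    if "1 \<le> k" "k \<le> n" for n k and f :: "(nat \<Rightarrow> nat) \<Rightarrow> nat \<Rightarrow> nat"
    unfolding block_min_law_def map_pmf_comp S_def total_def
    using that w_pos by (intro pmf_map_gibbs_pmf)
  have S_0: "S n k f = 0" if "total n k = 0" "k = 0 \<or> n < k" for k f
    using that assms(1) by (auto simp: S_def partitions_into_0 partitions_into_eq_empty)
  have "pmf (block_min_law w (Suc n) k) v = S (Suc n) k id / total (Suc n) k"
    using law[of k "Suc n" id] assms by simp
  also have "S (Suc n) k id = S n j (\<lambda>v. v(Suc n := 1)) + a n k * S n k (\<lambda>v. v(Suc n := 0))"
    unfolding S_def j id_def by (rule weighted_sum_Suc[where h = "\<lambda>u. of_bool (u = v)"])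
  also have "\<dots> / total (Suc n) k = S n j (\<lambda>v. v(Suc n := 1)) / total (Suc n) k +
      a n k * S n k (\<lambda>v. v(Suc n := 0)) / total (Suc n) k"
    by (simp add: add_divide_distrib)
  also have "S n j (\<lambda>v. v(Suc n := 1)) / total (Suc n) k =
      new_prob n k * pmf (map_pmf (\<lambda>v. v(Suc n := 1)) (block_min_law w n j)) v"
  proof (cases "j = 0")
    case True
    then show ?thesis
      using assms(1) by (simp add: S_0 total_eq_0 new_prob_def j)
  next
    case False
    then have "0 < total n j" "1 \<le> j" "j \<le> n" using assms j by (auto intro: total_pos)
    moreover have "new_prob n k = total n j / total (Suc n) k"
      using assms j by (auto simp: new_prob_def total_diag le_Suc_eq)
    ultimately show ?thesis by (simp add: law)
  qed
  also have "a n k * S n k (\<lambda>v. v(Suc n := 0)) / total (Suc n) k =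
      (1 - new_prob n k) * pmf (map_pmf (\<lambda>v. v(Suc n := 0)) (block_min_law w n k)) v"
  proof (cases "k \<le> n")
    case True
    then have pos: "0 < total n k" "0 < total (Suc n) k" using assms by (auto intro: total_pos)
    have "new_prob n k = total n j / total (Suc n) k"
      using True j by (simp add: new_prob_def)
    then have "1 - new_prob n k = a n k * total n k / total (Suc n) k"
      using pos by (simp add: j total_Suc field_simps)
    then show ?thesis using pos True assms by (simp add: law)
  next
    case False
    then show ?thesis
      by (simp add: S_0 total_eq_0 new_prob_def)
  qed
  finally show "pmf (block_min_law w (Suc n) k) v = pmf (bernoulli_pmf (new_prob n k) \<bind> (\<lambda>new.
    if new then map_pmf (\<lambda>v. v(Suc n := 1)) (block_min_law w n (k - 1))
    else map_pmf (\<lambda>v. v(Suc n := 0)) (block_min_law w n k))) v"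
    by (simp only: pmf_bernoulli_bind[OF new_prob_bounds] if_True if_False j diff_Suc_1)
qed

lemma monotone_coupling_exists:
  assumes "1 \<le> n"
  shows "\<exists>Q :: (nat \<Rightarrow> nat \<Rightarrow> nat) pmf.
    (\<forall>k\<in>{1..n}. map_pmf (\<lambda>\<omega>. \<omega> k) Q = block_min_law w n k) \<and>
    (\<forall>\<omega>\<in>set_pmf Q. \<forall>k\<in>{1..<n}. \<forall>i. \<omega> k i \<le> \<omega> (Suc k) i)"
  using assms
proof (induction n rule: dec_induct)
  case base
  let ?Q = "map_pmf (\<lambda>v _. v) (block_min_law w 1 1) :: (nat \<Rightarrow> nat \<Rightarrow> nat) pmf"
  have "map_pmf (\<lambda>\<omega>. \<omega> k) ?Q = block_min_law w 1 1" for k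
    by (simp add: map_pmf_comp)
  then show ?case by (intro exI[of _ ?Q]) auto
next
  case (step n)
  then obtain Q :: "(nat \<Rightarrow> nat \<Rightarrow> nat) pmf" where
    Q: "\<And>k. 1 \<le> k \<Longrightarrow> k \<le> n \<Longrightarrow> map_pmf (\<lambda>\<omega>. \<omega> k) Q = block_min_law w n k"
    "\<And>\<omega> k i. \<omega> \<in> set_pmf Q \<Longrightarrow> 1 \<le> k \<Longrightarrow> k < n \<Longrightarrow> \<omega> k i \<le> \<omega> (Suc k) i"
    by fastforce
  have "new_prob n k = 1" if "Suc n \<le> k" for k
    using that by (simp add: new_prob_def)
  moreover have "new_prob n 0 = 0" by (simp add: new_prob_def)
  ultimately obtain J where
    J: "\<And>k. map_pmf (\<lambda>j. j \<le> k) J = bernoulli_pmf (new_prob n k)"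
    "\<And>j. j \<in> set_pmf J \<Longrightarrow> new_prob n (j - 1) < new_prob n j"
    using threshold_pmf_exists[of "new_prob n", OF new_prob_mono] by metis
  \<comment> \<open>Hence \<open>ext\<close> below, for \<open>k\<close> from \<open>1\<close> to
    \<open>Suc n\<close>, never reads \<omega> at \<open>0\<close> or \<open>Suc n\<close>, where
    \<open>Q\<close> carries no information.\<close>
  have J_range: "2 \<le> j \<and> j \<le> Suc n" if "j \<in> set_pmf J" for j
  proof -
    have "new_prob n 1 = 0" using step(1) by (simp add: new_prob_def total_eq_0)
    moreover have "new_prob n 0 = 0" by (simp add: new_prob_def)
    moreover have "j \<noteq> 0" using J(2)[OF that] by (cases j) auto
    ultimately have "j \<noteq> 1" using J(2)[OF that] by auto
    have "j \<le> Suc n"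
    proof (rule ccontr)
      assume "\<not> j \<le> Suc n"
      then have "new_prob n (j - 1) = 1" "new_prob n j = 1" by (auto simp: new_prob_def)
      with J(2)[OF that] show False by simp
    qed
    with \<open>j \<noteq> 0\<close> \<open>j \<noteq> 1\<close> show ?thesis by linarith
  qed
  define ext where "ext j \<omega> k = (if j \<le> k then (\<omega> (k - 1))(Suc n := 1) else (\<omega> k)(Suc n := 0))"
    for j k :: nat and \<omega> :: "nat \<Rightarrow> nat \<Rightarrow> nat"
  define Q' where "Q' = J \<bind> (\<lambda>j. map_pmf (ext j) Q)"
  have "map_pmf (\<lambda>\<omega>. \<omega> k) Q' = block_min_law w (Suc n) k" if k: "1 \<le> k" "k \<le> Suc n" for k
  proof -
    let ?f = "\<lambda>new. if new then map_pmf (\<lambda>v. v(Suc n := 1)) (block_min_law w n (k - 1))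
        else map_pmf (\<lambda>v. v(Suc n := 0)) (block_min_law w n k)"
    have "map_pmf (\<lambda>\<omega>. \<omega> k) Q' = J \<bind> (\<lambda>j. map_pmf (\<lambda>\<omega>. ext j \<omega> k) Q)"
      by (simp add: Q'_def map_bind_pmf map_pmf_comp)
    also have "\<dots> = J \<bind> (\<lambda>j. ?f (j \<le> k))"
    proof (rule bind_pmf_cong[OF refl])
      fix j assume j: "j \<in> set_pmf J"
      show "map_pmf (\<lambda>\<omega>. ext j \<omega> k) Q = ?f (j \<le> k)"
      proof (cases "j \<le> k")
        case True
        then have "map_pmf (\<lambda>\<omega>. \<omega> (k - 1)) Q = block_min_law w n (k - 1)"
          using J_range[OF j] k by (intro Q(1)) auto
        moreover have "map_pmf (\<lambda>\<omega>. ext j \<omega> k) Q =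
            map_pmf (\<lambda>v. v(Suc n := 1)) (map_pmf (\<lambda>\<omega>. \<omega> (k - 1)) Q)"
          using True by (simp add: ext_def map_pmf_comp)
        ultimately show ?thesis using True by simp
      next
        case False
        then have "map_pmf (\<lambda>\<omega>. \<omega> k) Q = block_min_law w n k"
          using J_range[OF j] k by (intro Q(1)) auto
        moreover have "map_pmf (\<lambda>\<omega>. ext j \<omega> k) Q =
            map_pmf (\<lambda>v. v(Suc n := 0)) (map_pmf (\<lambda>\<omega>. \<omega> k) Q)"
          using False by (simp add: ext_def map_pmf_comp)
        ultimately show ?thesis using False by simp
      qed
    qed
    also have "\<dots> = bernoulli_pmf (new_prob n k) \<bind> ?f"
      unfolding J(1)[symmetric] by (simp add: bind_map_pmf)
    finally show ?thesis using block_min_law_Suc[OF step(1) k] by simp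
  qed
  moreover have "\<omega>' k i \<le> \<omega>' (Suc k) i" if \<omega>': "\<omega>' \<in> set_pmf Q'" and k: "1 \<le> k" "k \<le> n" for \<omega>' k i
  proof -
    obtain j \<omega> where j: "j \<in> set_pmf J" and \<omega>: "\<omega> \<in> set_pmf Q" "\<omega>' = ext j \<omega>"
      using \<omega>' by (auto simp: Q'_def)
    \<comment> \<open>Either both vectors get a new block and come from neighbours one step lower,
      or both extend \<omega> at \<open>k\<close>, by \<open>0\<close> and \<open>1\<close>, or
      neither gets a new block.\<close>
    consider "j \<le> k" | "j = Suc k" | "Suc k < j" by linarith
    then show ?thesis
    proof cases
      case 1
      then have "\<omega> (k - 1) i \<le> \<omega> (Suc (k - 1)) i"
        using J_range[OF j] k by (intro Q(2)[OF \<omega>(1)]) auto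
      then show ?thesis using 1 k by (simp add: \<omega>(2) ext_def)
    next
      case 2
      then show ?thesis by (simp add: \<omega>(2) ext_def)
    next
      case 3
      then have "\<omega> k i \<le> \<omega> (Suc k) i"
        using J_range[OF j] k by (intro Q(2)[OF \<omega>(1)]) auto
      then show ?thesis using 3 by (simp add: \<omega>(2) ext_def)
    qed
  qed
  ultimately show ?case by (intro exI[of _ Q']) auto
qed

end

section \<open>The weights of the theorem satisfy the recursion\<close>

text \<open>With \<open>s = n - x k\<close> the growth condition becomes
  \<open>x (1 - x) D \<le> s\<^sup>2 + s + x (1 - x)\<close>. The constant \<open>4\<close> in
  \<open>D\<close> is the one from the inequality of arithmetic and geometric means.\<close>

lemma gibbs_recursion_finite:
  fixes x :: real
  assumes "x < 1"
  shows "gibbs_recursion (gibbs_alpha_weight (ereal x)) (\<lambda>j. real j - x) (\<lambda>n k. real n - x * real k)"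
proof
  show "gibbs_alpha_weight (ereal x) 1 = 1" by (simp add: gibbs_alpha_weight_def)
  show "gibbs_alpha_weight (ereal x) (Suc j) = (real j - x) * gibbs_alpha_weight (ereal x) j"
    if "1 \<le> j" for j
    using that by (simp add: gibbs_alpha_weight_def prod.atLeastLessThan_Suc)
  show "0 < real j - x" if "1 \<le> j" for j using that assms by simp
  show "(\<Sum>A\<in>P. real (card A) - x) = real n - x * real k" if "P \<in> partitions_into n k" for P n k
    using finite_partition_parts(5)[OF that]
    by (simp add: sum_subtractf flip: sum_card_partition[OF that])
  show "real n - x * real n = real n * (real 1 - x)" for n by (simp add: algebra_simps)
  show "real n - x * real k \<le> real (Suc n) - x * real (Suc k)" for n k
    using assms by (simp add: algebra_simps)
  show "(4 * (real n - real k) * real n - 1) *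
      ((real n - x * real (k - 1)) * (real (Suc n) - x * real (Suc k))) \<le>
    4 * (real n - real k) * real n * ((real n - x * real k) * (real (Suc n) - x * real k))"
    if "2 \<le> k" "k < n" for k n
  proof -
    define s D where "s = real n - x * real k" and "D = 4 * (real n - real k) * real n"
    have "x * real k \<le> 1 * real k" using assms by (intro mult_right_mono) auto
    also have "\<dots> \<le> real n" using that by simp
    finally have s: "0 \<le> s" by (simp add: s_def)
    have "1 * 1 \<le> 4 * (real n - real k) * real n" using that by (intro mult_mono) auto
    then have D: "1 \<le> D" by (simp add: D_def)
    \<comment> \<open>\<open>s\<close> is the weighted mean of \<open>n - k\<close> and \<open>n\<close> with weights \<open>x\<close> and \<open>1 - x\<close>.\<close>
    have "s\<^sup>2 - x * (1 - x) * D = (x * (real n - real k) - (1 - x) * real n)\<^sup>2"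
      by (simp add: s_def D_def power2_eq_square algebra_simps)
    then have amgm: "x * (1 - x) * D \<le> s\<^sup>2" by (smt (verit) zero_le_power2)
    have "x * (1 - x) * D \<le> s\<^sup>2 + s + x * (1 - x)"
    proof (cases "0 \<le> x")
      case True
      then have "0 \<le> x * (1 - x)" using assms by simp
      with amgm s show ?thesis by linarith
    next
      \<comment> \<open>For negative \<open>x\<close> the last term on the right is negative, and
        \<open>1 \<le> D\<close> compensates for it.\<close>
      case False
      then have "x * (1 - x) * D \<le> x * (1 - x) * 1"
        using assms D by (intro mult_left_mono_neg mult_nonpos_nonneg) auto
      with s zero_le_power2[of s] show ?thesis by linarith
    qed
    then have "(D - 1) * ((s + x) * (s + (1 - x))) \<le> D * (s * (s + 1))"
      by (simp add: algebra_simps power2_eq_square)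
    moreover have "real n - x * real (k - 1) = s + x"
        "real (Suc n) - x * real (Suc k) = s + (1 - x)" "real (Suc n) - x * real k = s + 1"
      using that by (simp_all add: s_def of_nat_diff algebra_simps)
    ultimately show ?thesis
      by (simp only: D_def[symmetric] s_def[symmetric])
  qed
qed

text \<open>All weights are \<open>1\<close>, so the totals are Stirling numbers of the second kind;
  growth follows from \<open>(k - 1) (k + 1) \<le> k\<^sup>2\<close>.\<close>

lemma gibbs_recursion_minus_infinity:
  "gibbs_recursion (gibbs_alpha_weight (-\<infinity>)) (\<lambda>_. 1) (\<lambda>n k. real k)"
proof
  show "(4 * (real n - real k) * real n - 1) * (real (k - 1) * real (Suc k)) \<le>
    4 * (real n - real k) * real n * (real k * real k)" if "2 \<le> k" "k < n" for k n
  proof (rule mult_mono)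
    show "real (k - 1) * real (Suc k) \<le> real k * real k"
      using that by (simp add: of_nat_diff algebra_simps)
  qed (use that in auto)
qed (auto simp: gibbs_alpha_weight_def dest: finite_partition_parts(5))

theorem proposition4p1:
  fixes \<alpha> :: ereal and n :: nat
  assumes "\<alpha> < 1" and "n \<ge> 1"
  shows "\<exists>(M :: (nat \<Rightarrow> nat \<Rightarrow> nat) measure)
            (B :: nat \<Rightarrow> nat \<Rightarrow> (nat \<Rightarrow> nat \<Rightarrow> nat) \<Rightarrow> nat).
     prob_space M \<and>
     (\<forall>k\<in>{1..n}.
        (\<lambda>\<omega>. \<lambda>i\<in>{1..n}. B k i \<omega>) \<in> measurable M (count_space UNIV) \<and>
        distr M (count_space UNIV) (\<lambda>\<omega>. \<lambda>i\<in>{1..n}. B k i \<omega>)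
          = measure_pmf (block_min_law (gibbs_alpha_weight \<alpha>) n k)) \<and>
     (\<forall>\<omega>\<in>space M. \<forall>i\<in>{1..n}. \<forall>k\<in>{1..n - 1}. B k i \<omega> \<le> B (k + 1) i \<omega>)"
proof -
  let ?w = "gibbs_alpha_weight \<alpha>"
  obtain b a where "gibbs_recursion ?w b a"
  proof (cases \<alpha>)
    case (real x)
    then show ?thesis using that gibbs_recursion_finite[of x] assms(1) by auto
  next
    case MInf
    then show ?thesis using that gibbs_recursion_minus_infinity by auto
  qed (use assms(1) in auto)
  then interpret gibbs_recursion ?w b a .
  obtain Q :: "(nat \<Rightarrow> nat \<Rightarrow> nat) pmf" where
    Q: "\<And>k. k \<in> {1..n} \<Longrightarrow> map_pmf (\<lambda>\<omega>. \<omega> k) Q = block_min_law ?w n k"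
    "\<And>\<omega> k i. \<omega> \<in> set_pmf Q \<Longrightarrow> k \<in> {1..<n} \<Longrightarrow> \<omega> k i \<le> \<omega> (Suc k) i"
    using monotone_coupling_exists[OF assms(2)] by blast
  \<comment> \<open>Off the support of \<open>Q\<close>, a null set, the vectors are set to 0 to make them monotone.\<close>
  define B where "B k i \<omega> = (if \<omega> \<in> set_pmf Q then \<omega> k i else 0)"
    for k i and \<omega> :: "nat \<Rightarrow> nat \<Rightarrow> nat"
  have "distr Q (count_space UNIV) (\<lambda>\<omega>. \<lambda>i\<in>{1..n}. B k i \<omega>) = block_min_law ?w n k"
    if "k \<in> {1..n}" for k
  proof -
    have "distr Q (count_space UNIV) (\<lambda>\<omega>. \<lambda>i\<in>{1..n}. B k i \<omega>) =
        measure_pmf (map_pmf (\<lambda>\<omega>. \<lambda>i\<in>{1..n}. B k i \<omega>) Q)"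
      by (simp add: map_pmf_rep_eq)
    also have "map_pmf (\<lambda>\<omega>. \<lambda>i\<in>{1..n}. B k i \<omega>) Q = map_pmf (\<lambda>\<omega>. restrict (\<omega> k) {1..n}) Q"
      by (rule map_pmf_cong) (auto simp: B_def fun_eq_iff)
    also have "\<dots> = map_pmf (\<lambda>v. restrict v {1..n}) (block_min_law ?w n k)"
      by (simp add: Q(1)[OF that, symmetric] map_pmf_comp)
    \<comment> \<open>The law already lives on functions restricted to
      \<open>{1..n}\<close>.\<close>
    also have "\<dots> = block_min_law ?w n k"
      by (simp add: block_min_law_def map_pmf_comp)
    finally show ?thesis .
  qed
  moreover have "B k i \<omega> \<le> B (k + 1) i \<omega>" if "k \<in> {1..n - 1}" for k i \<omega>
    using Q(2)[of \<omega> k i] that by (auto simp: B_def)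
  ultimately show ?thesis
    by (intro exI[of _ "measure_pmf Q"] exI[of _ B]) (auto simp: measure_pmf.prob_space_axioms)
qed

end
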